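(* In CCSK with its proved labelled transition system, for all (reachable) processes $X,X_1,Y$ and enhanced keyed labels $\theta_1,\theta_2$ with $X\xrightarrow{\theta_1}X_1\overset{\theta_2}{\rightsquigarrow}Y$ (a forward transition followed by a backward one) and $\theta_1\smile\theta_2$ (in this trace), there exists $X_2$ such that $X\overset{\theta_2}{\rightsquigarrow}X_2\xrightarrow{\theta_1}Y$.
   Context: **Syntax of CCSK.** Let $\mathsf N=\{a,b,c,\dots\}$ be a set of names, $\overline{\mathsf N}=\{\bar a,\bar b,\bar c,\dots\}$ the set of co-names, with a bijection $\overline{\,\cdot\,}:\mathsf N\to\overline{\mathsf N}$ whose inverse is also written $\overline{\,\cdot\,}$. Labels: $\mathsf L=\mathsf N\cup\overline{\mathsf N}\cup\{\tau\}$; $\alpha,\beta$ range over $\mathsf L$ and $\lambda$ over $\mathsf L\setminus\{\tau\}$. Let $\mathsf K=\{m,n,\dots\}$ be a set of keys, ranged over by $k$. Processes: $X,Y ::= 0 \mid \alpha.X \mid \alpha[k].X \mid X\backslash a \mid X+Y \mid (X\mid Y)$. $\mathrm{key}(X)$ is the set of keys occurring in $X$; $X$ is standard, $\mathrm{std}(X)$, iff $\mathrm{key}(X)=\emptyset$. **Enhanced keyed labels.** With $\upsilon,\upsilon_L,\upsilon_R$ strings in $\{|_L,|_R\}^*$: $\theta ::= \upsilon\alpha[k]$ or $\upsilon\langle |_L\upsilon_L\alpha[k],\ |_R\upsilon_R\bar\alpha[k]\rangle$. Put $\ell(\upsilon\alpha[k])=\alpha$, $\ell$ of the second form $=\tau$,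 and $\kappa(\theta)=k$ in both cases. **Proved LTS.** Forward transitions $X\xrightarrow{\theta}X'$ are inductively generated by: - (act.) $\alpha.X\xrightarrow{\alpha[k]}\alpha[k].X$ if $\mathrm{std}(X)$; - (pre.) $\alpha[k].X\xrightarrow{\theta}\alpha[k].X'$ if $X\xrightarrow{\theta}X'$ and $\kappa(\theta)\neq k$; - (res.) $X\backslash a\xrightarrow{\theta}X'\backslash a$ if $X\xrightarrow{\theta}X'$ and $\ell(\theta)\notin\{a,\bar a\}$; - ($|_L$) $X\mid Y\xrightarrow{|_L\theta}X'\mid Y$ if $X\xrightarrow{\theta}X'$ and $\kappa(\theta)\notin\mathrm{key}(Y)$; ($|_R$) symmetrically, $X\mid Y\xrightarrow{|_R\theta}X\mid Y'$ if $Y\xrightarrow{\theta}Y'$ and $\kappa(\theta)\notin\mathrm{key}(X)$; - (syn.) $X\mid Y\xrightarrow{\langle |_L\upsilon_L\lambda[k],\,|_R\upsilon_R\bar\lambda[k]\rangle}X'\mid Y'$ if $X\xrightarrow{\upsilon_L\lambda[k]}X'$ and $Y\xrightarrow{\upsilon_R\bar\lambda[k]}Y'$; - ($+_L$) $X+Y\xrightarrow{\theta}X'+Y$ if $X\xrightarrow{\theta}X'$ and $\mathrm{std}(Y)$; ($+_R$) symmetrically. Backward transitions $X'\overset{\theta}{\rightsquigarrow}X$ are generated by the exact symmetric rules (source and target exchanged in premises and conclusion, same labels and side conditions). Write $X\overset{\theta}{\twoheadrightarrow}Y$ if $X\xrightarrow{\theta}Y$ or $X\overset{\theta}{\rightsquigarrow}Y$.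 A process $X$ is reachable if there is a standard $O_X$ from which $X$ is reached by a finite sequence of $\twoheadrightarrow$-steps. All processes considered are reachable. **Dependency and concurrency.** The dependency relation $\lessdot$ on enhanced keyed labels is induced by (is the least relation satisfying), for $d\in\{L,R\}$: $\alpha[k]\lessdot\theta$ for every $\theta$; $|_d\theta\lessdot|_d\theta'$ if $\theta\lessdot\theta'$; $\langle\theta_L,\theta_R\rangle\lessdot\theta$ if $\theta_d\lessdot\theta$ for some $d$; $\theta\lessdot\langle\theta_L,\theta_R\rangle$ if $\theta\lessdot\theta_d$ for some $d$; $\langle\theta_L,\theta_R\rangle\lessdot\langle\theta_L',\theta_R'\rangle$ if $\theta_d\lessdot\theta_d'$ for some $d$. (Here $\theta_L,\theta_R$ include their leading $|_L$, $|_R$.) In a trace $T:X_1\overset{\theta_1}{\twoheadrightarrow}\cdots\overset{\theta_n}{\twoheadrightarrow}X_{n+1}$, for $i<j$, $\theta_i\lessdot_T\theta_j$ iff $\theta_i\lessdot\theta_j$; and $\theta_i\smile_T\theta_j$ (written also $\theta_i\smile\theta_j$; "concurrent") iff neither $\theta_i\lessdot_T\theta_j$ nor $\theta_j\lessdot_T\theta_i$. Thus for $i<j$, $\theta_i\smile_T\theta_j$ iff not $\theta_i\lessdot\theta_j$. *)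

theory Defs
  imports Main
begin

(* Names and keys are drawn from arbitrary types 'n and 'k. *)

datatype 'n label = Name 'n | CoName 'n | Tau

(* The grammar of enhanced keyed labels mentions the complement of an arbitrary label, so
   complementation is made total by the convention that Tau is self-complementary.
   No transition depends on this: the synchronisation rules exclude Tau. *)
primrec bar :: "'n label \<Rightarrow> 'n label" where
  "bar (Name a) = CoName a"
| "bar (CoName a) = Name a"
| "bar Tau = Tau"

datatype ('n, 'k) proc =
    Null
  | Pre "'n label" "('n, 'k) proc"
  | KPre "'n label" 'k "('n, 'k) proc"
  | Res "('n, 'k) proc" 'n
  | Choice "('n, 'k) proc" "('n, 'k) proc"
  | Par "('n, 'k) proc" "('n, 'k) proc"

primrec keys :: "('n, 'k) proc \<Rightarrow> 'k set" where
  "keys Null = {}"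
| "keys (Pre \<alpha> X) = keys X"
| "keys (KPre \<alpha> k X) = insert k (keys X)"
| "keys (Res X a) = keys X"
| "keys (Choice X Y) = keys X \<union> keys Y"
| "keys (Par X Y) = keys X \<union> keys Y"

definition std :: "('n, 'k) proc \<Rightarrow> bool" where
  "std X \<longleftrightarrow> keys X = {}"

datatype side = L | R

(* Act u \<alpha> k stands for u \<alpha>[k], and Syn u v \<alpha> w k for
   u \<langle> |_L v \<alpha>[k], |_R w (bar \<alpha>)[k] \<rangle>; the leading |_L and |_R
   of the two components are not part of the strings v and w. *)
datatype ('n, 'k) elabel =
    Act "side list" "'n label" 'k
  | Syn "side list" "side list" "'n label" "side list" 'k

primrec lab :: "('n, 'k) elabel \<Rightarrow> 'n label" where
  "lab (Act u \<alpha> k) = \<alpha>"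
| "lab (Syn u v \<alpha> w k) = Tau"

primrec lkey :: "('n, 'k) elabel \<Rightarrow> 'k" where
  "lkey (Act u \<alpha> k) = k"
| "lkey (Syn u v \<alpha> w k) = k"

(* push d \<theta> is |_d \<theta> *)
primrec push :: "side \<Rightarrow> ('n, 'k) elabel \<Rightarrow> ('n, 'k) elabel" where
  "push d (Act u \<alpha> k) = Act (d # u) \<alpha> k"
| "push d (Syn u v \<alpha> w k) = Syn (d # u) v \<alpha> w k"

inductive fwd :: "('n, 'k) proc \<Rightarrow> ('n, 'k) elabel \<Rightarrow> ('n, 'k) proc \<Rightarrow> bool"
    ("_ \<midarrow>_\<rightarrow> _" [51, 0, 51] 50) where
  fwd_act: "std X \<Longrightarrow> Pre \<alpha> X \<midarrow>Act [] \<alpha> k\<rightarrow> KPre \<alpha> k X"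
| fwd_pre: "X \<midarrow>\<theta>\<rightarrow> X' \<Longrightarrow> lkey \<theta> \<noteq> k \<Longrightarrow> KPre \<alpha> k X \<midarrow>\<theta>\<rightarrow> KPre \<alpha> k X'"
| fwd_res: "X \<midarrow>\<theta>\<rightarrow> X' \<Longrightarrow> lab \<theta> \<notin> {Name a, CoName a} \<Longrightarrow> Res X a \<midarrow>\<theta>\<rightarrow> Res X' a"
| fwd_parL: "X \<midarrow>\<theta>\<rightarrow> X' \<Longrightarrow> lkey \<theta> \<notin> keys Y \<Longrightarrow> Par X Y \<midarrow>push L \<theta>\<rightarrow> Par X' Y"
| fwd_parR: "Y \<midarrow>\<theta>\<rightarrow> Y' \<Longrightarrow> lkey \<theta> \<notin> keys X \<Longrightarrow> Par X Y \<midarrow>push R \<theta>\<rightarrow> Par X Y'"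
| fwd_syn: "X \<midarrow>Act v \<alpha> k\<rightarrow> X' \<Longrightarrow> Y \<midarrow>Act w (bar \<alpha>) k\<rightarrow> Y' \<Longrightarrow> \<alpha> \<noteq> Tau \<Longrightarrow>
    Par X Y \<midarrow>Syn [] v \<alpha> w k\<rightarrow> Par X' Y'"
| fwd_sumL: "X \<midarrow>\<theta>\<rightarrow> X' \<Longrightarrow> std Y \<Longrightarrow> Choice X Y \<midarrow>\<theta>\<rightarrow> Choice X' Y"
| fwd_sumR: "Y \<midarrow>\<theta>\<rightarrow> Y' \<Longrightarrow> std X \<Longrightarrow> Choice X Y \<midarrow>\<theta>\<rightarrow> Choice X Y'"

inductive bwd :: "('n, 'k) proc \<Rightarrow> ('n, 'k) elabel \<Rightarrow> ('n, 'k) proc \<Rightarrow> bool"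
    ("_ \<midarrow>_\<leadsto> _" [51, 0, 51] 50) where
  bwd_act: "std X \<Longrightarrow> KPre \<alpha> k X \<midarrow>Act [] \<alpha> k\<leadsto> Pre \<alpha> X"
| bwd_pre: "X' \<midarrow>\<theta>\<leadsto> X \<Longrightarrow> lkey \<theta> \<noteq> k \<Longrightarrow> KPre \<alpha> k X' \<midarrow>\<theta>\<leadsto> KPre \<alpha> k X"
| bwd_res: "X' \<midarrow>\<theta>\<leadsto> X \<Longrightarrow> lab \<theta> \<notin> {Name a, CoName a} \<Longrightarrow> Res X' a \<midarrow>\<theta>\<leadsto> Res X a"
| bwd_parL: "X' \<midarrow>\<theta>\<leadsto> X \<Longrightarrow> lkey \<theta> \<notin> keys Y \<Longrightarrow> Par X' Y \<midarrow>push L \<theta>\<leadsto> Par X Y"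
| bwd_parR: "Y' \<midarrow>\<theta>\<leadsto> Y \<Longrightarrow> lkey \<theta> \<notin> keys X \<Longrightarrow> Par X Y' \<midarrow>push R \<theta>\<leadsto> Par X Y"
| bwd_syn: "X' \<midarrow>Act v \<alpha> k\<leadsto> X \<Longrightarrow> Y' \<midarrow>Act w (bar \<alpha>) k\<leadsto> Y \<Longrightarrow> \<alpha> \<noteq> Tau \<Longrightarrow>
    Par X' Y' \<midarrow>Syn [] v \<alpha> w k\<leadsto> Par X Y"
| bwd_sumL: "X' \<midarrow>\<theta>\<leadsto> X \<Longrightarrow> std Y \<Longrightarrow> Choice X' Y \<midarrow>\<theta>\<leadsto> Choice X Y"
| bwd_sumR: "Y' \<midarrow>\<theta>\<leadsto> Y \<Longrightarrow> std X \<Longrightarrow> Choice X Y' \<midarrow>\<theta>\<leadsto> Choice X Y"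

definition step :: "('n, 'k) proc \<Rightarrow> ('n, 'k) elabel \<Rightarrow> ('n, 'k) proc \<Rightarrow> bool"
    ("_ \<midarrow>_\<Rrightarrow> _" [51, 0, 51] 50) where
  "X \<midarrow>\<theta>\<Rrightarrow> Y \<longleftrightarrow> X \<midarrow>\<theta>\<rightarrow> Y \<or> X \<midarrow>\<theta>\<leadsto> Y"

inductive trace :: "('n, 'k) proc \<Rightarrow> ('n, 'k) elabel list \<Rightarrow> ('n, 'k) proc \<Rightarrow> bool" where
  trace_nil: "trace X [] X"
| trace_cons: "X \<midarrow>\<theta>\<Rrightarrow> Y \<Longrightarrow> trace Y T Z \<Longrightarrow> trace X (\<theta> # T) Z"

definition reachable :: "('n, 'k) proc \<Rightarrow> bool" where
  "reachable X \<longleftrightarrow> (\<exists>X0 T. std X0 \<and> trace X0 T X)"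

(* half d v \<alpha> w is the d-component of Syn [] v \<alpha> w, including its leading |_d *)
primrec half :: "side \<Rightarrow> side list \<Rightarrow> 'n label \<Rightarrow> side list \<Rightarrow> 'k \<Rightarrow> ('n, 'k) elabel" where
  "half L v \<alpha> w k = Act (L # v) \<alpha> k"
| "half R v \<alpha> w k = Act (R # w) (bar \<alpha>) k"

inductive dep :: "('n, 'k) elabel \<Rightarrow> ('n, 'k) elabel \<Rightarrow> bool" (infix "\<lessdot>" 50) where
  dep_act: "Act [] \<alpha> k \<lessdot> \<theta>"
| dep_push: "\<theta> \<lessdot> \<theta>' \<Longrightarrow> push d \<theta> \<lessdot> push d \<theta>'"
| dep_synL: "half d v \<alpha> w k \<lessdot> \<theta> \<Longrightarrow> Syn [] v \<alpha> w k \<lessdot> \<theta>"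
| dep_synR: "\<theta> \<lessdot> half d v \<alpha> w k \<Longrightarrow> \<theta> \<lessdot> Syn [] v \<alpha> w k"
| dep_syn: "half d v \<alpha> w k \<lessdot> half d v' \<alpha>' w' k' \<Longrightarrow> Syn [] v \<alpha> w k \<lessdot> Syn [] v' \<alpha>' w' k'"

(* In a trace, dependency and concurrency relate positions (counted from 0) and are
   determined by the list T of labels along the trace. *)
definition dep_in :: "('n, 'k) elabel list \<Rightarrow> nat \<Rightarrow> nat \<Rightarrow> bool" where
  "dep_in T i j \<longleftrightarrow> i < j \<and> j < length T \<and> T ! i \<lessdot> T ! j"

definition concurrent_in :: "('n, 'k) elabel list \<Rightarrow> nat \<Rightarrow> nat \<Rightarrow> bool" where
  "concurrent_in T i j \<longleftrightarrow>
    i < length T \<and> j < length T \<and> i \<noteq> j \<and> \<not> dep_in T i j \<and> \<not> dep_in T j i"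

end

(* Backward transitions are the converses of forward ones, so the claim is that two forward
   transitions X -- \<theta>1 --> X1 and Y -- \<theta>2 --> X1 into the same process have a common origin,
   provided that not \<theta>1 \<lessdot> \<theta>2.  This follows by induction on the first transition.  When the
   two transitions act in different places, the side conditions are preserved because a forward
   transition only adds keys. *)
theory Submission
  imports Defs
begin

lemma bwd_imp_fwd: "X \<midarrow>\<theta>\<leadsto> Y \<Longrightarrow> Y \<midarrow>\<theta>\<rightarrow> X"
  by (induction rule: bwd.induct) (auto intro: fwd.intros)

lemma fwd_imp_bwd: "X \<midarrow>\<theta>\<rightarrow> Y \<Longrightarrow> Y \<midarrow>\<theta>\<leadsto> X"
  by (induction rule: fwd.induct) (auto intro: bwd.intros)

lemma bwd_iff_fwd: "X \<midarrow>\<theta>\<leadsto> Y \<longleftrightarrow> Y \<midarrow>\<theta>\<rightarrow> X"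
  using bwd_imp_fwd fwd_imp_bwd by blast

lemma lkey_push [simp]: "lkey (push d \<theta>) = lkey \<theta>"
  by (cases \<theta>) auto

text \<open>Used twice: the target of a transition is never standard, and a key absent from a target
  is absent from its source, which is how side conditions are carried back to the common
  origin.\<close>

lemma fwd_keys: "X \<midarrow>\<theta>\<rightarrow> X' \<Longrightarrow> keys X' = insert (lkey \<theta>) (keys X)"
  by (induction rule: fwd.induct) auto

lemma fwd_not_std: "X \<midarrow>\<theta>\<rightarrow> X' \<Longrightarrow> \<not> std X'"
  by (simp add: fwd_keys std_def)

text \<open>The second transition is known only through the process it shares with the first, so
  inversion is on the shape of the target.\<close>

inductive_cases fwd_to_KPreE: "Y \<midarrow>\<theta>\<rightarrow> KPre \<alpha> k X"
inductive_cases fwd_to_ResE: "Y \<midarrow>\<theta>\<rightarrow> Res X a"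
inductive_cases fwd_to_ChoiceE: "Y \<midarrow>\<theta>\<rightarrow> Choice X X'"
inductive_cases fwd_to_ParE: "Y \<midarrow>\<theta>\<rightarrow> Par X X'"

text \<open>\<open>push L (Act v \<alpha> k)\<close> is the left \<open>half\<close> of the
  synchronisation for every \<open>w\<close>, so a dependency inside the left component lifts first
  along \<open>push\<close> and then to the whole \<open>Syn\<close> label.\<close>

lemma push_L_Act_dep:
  "Act v \<alpha> k \<lessdot> \<theta> \<Longrightarrow> Syn [] v \<alpha> w k \<lessdot> push L \<theta>"
  "\<theta> \<lessdot> Act v \<alpha> k \<Longrightarrow> push L \<theta> \<lessdot> Syn [] v \<alpha> w k"
  using dep_push[of "Act v \<alpha> k" \<theta> L] dep_push[of \<theta> "Act v \<alpha> k" L]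
  by (auto intro: dep_synL[where d = L] dep_synR[where d = L])

lemma push_R_Act_dep:
  "Act w (bar \<alpha>) k \<lessdot> \<theta> \<Longrightarrow> Syn [] v \<alpha> w k \<lessdot> push R \<theta>"
  "\<theta> \<lessdot> Act w (bar \<alpha>) k \<Longrightarrow> push R \<theta> \<lessdot> Syn [] v \<alpha> w k"
  using dep_push[of "Act w (bar \<alpha>) k" \<theta> R] dep_push[of \<theta> "Act w (bar \<alpha>) k" R]
  by (auto intro: dep_synL[where d = R] dep_synR[where d = R])

lemma Syn_dep_SynI:
  "Act v \<alpha> k \<lessdot> Act v' \<alpha>' k' \<Longrightarrow> Syn [] v \<alpha> w k \<lessdot> Syn [] v' \<alpha>' w' k'"
  "Act w (bar \<alpha>) k \<lessdot> Act w' (bar \<alpha>') k' \<Longrightarrow> Syn [] v \<alpha> w k \<lessdot> Syn [] v' \<alpha>' w' k'"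
  using dep_push[of "Act v \<alpha> k" "Act v' \<alpha>' k'" L]
    dep_push[of "Act w (bar \<alpha>) k" "Act w' (bar \<alpha>') k'" R]
  by (auto intro: dep_syn[where d = L] dep_syn[where d = R])

text \<open>\<open>Y\<close> and \<open>\<theta>2\<close> stay arbitrary because the induction
  hypothesis is applied to component processes, whose labels have lost a leading side or are halves
  of a synchronisation.\<close>

lemma fwd_common_origin:
  assumes "X \<midarrow>\<theta>1\<rightarrow> X1" and "Y \<midarrow>\<theta>2\<rightarrow> X1" and "\<not> \<theta>1 \<lessdot> \<theta>2"
  shows "\<exists>X2. X2 \<midarrow>\<theta>2\<rightarrow> X \<and> X2 \<midarrow>\<theta>1\<rightarrow> Y"
  using assms
proof (induction arbitrary: Y \<theta>2 rule: fwd.induct)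
  case (fwd_act X \<alpha> k)
  \<comment> \<open>\<open>Act [] \<alpha> k\<close> precedes every label, contradicting the assumed
    independence.\<close>
  then show ?case by (auto intro: dep_act)
next
  case (fwd_pre X \<theta> X' k \<alpha>)
  from fwd_pre.prems(1) show ?case
    \<comment> \<open>Had the second transition created the prefix itself, \<open>X'\<close> would
      be standard, yet it is the target of the first one.\<close>
    by (rule fwd_to_KPreE) (use fwd_pre fwd_not_std in \<open>blast intro: fwd.intros\<close>)+
next
  case (fwd_res X \<theta> X' a)
  from fwd_res.prems(1) show ?case
    by (rule fwd_to_ResE) (use fwd_res in \<open>blast intro: fwd.intros\<close>)
next
  case (fwd_parL X \<theta> X' Y0)
  from fwd_parL.prems(1) show ?case
  proof (rule fwd_to_ParE)
    fix Z \<phi> assume *: "\<theta>2 = push L \<phi>" "Y = Par Z Y0" "Z \<midarrow>\<phi>\<rightarrow> X'" "lkey \<phi> \<notin> keys Y0"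
    then have "\<not> \<theta> \<lessdot> \<phi>" using fwd_parL.prems(2) by (auto intro: dep_push)
    with fwd_parL.IH * obtain X2 where "X2 \<midarrow>\<phi>\<rightarrow> X" "X2 \<midarrow>\<theta>\<rightarrow> Z" by blast
    then show ?thesis using * fwd_parL.hyps by (blast intro: fwd.intros)
  next
    fix Z \<phi> assume *: "\<theta>2 = push R \<phi>" "Y = Par X' Z" "Z \<midarrow>\<phi>\<rightarrow> Y0" "lkey \<phi> \<notin> keys X'"
    \<comment> \<open>The transitions act on opposite sides; the origin is \<open>Par X Z\<close>,
      whose components have no more keys than \<open>X'\<close> and \<open>Y0\<close>.\<close>
    then have "lkey \<phi> \<notin> keys X" "lkey \<theta> \<notin> keys Z"
      using fwd_keys fwd_parL.hyps by blast+
    then show ?thesis using * fwd_parL.hyps by (blast intro: fwd.intros)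
  next
    fix Z v \<alpha> k Z' w
    assume *: "\<theta>2 = Syn [] v \<alpha> w k" "Y = Par Z Z'"
      "Z \<midarrow>Act v \<alpha> k\<rightarrow> X'" "Z' \<midarrow>Act w (bar \<alpha>) k\<rightarrow> Y0" "\<alpha> \<noteq> Tau"
    \<comment> \<open>Only the left half of the synchronisation meets \<open>\<theta>\<close>; its
      right half is undone unchanged, giving the origin \<open>Par X2 Z'\<close>.\<close>
    then have "\<not> \<theta> \<lessdot> Act v \<alpha> k" using fwd_parL.prems(2) by (auto intro: push_L_Act_dep)
    with fwd_parL.IH * obtain X2 where "X2 \<midarrow>Act v \<alpha> k\<rightarrow> X" "X2 \<midarrow>\<theta>\<rightarrow> Z" by blast
    moreover have "lkey \<theta> \<notin> keys Z'" using fwd_keys * fwd_parL.hyps by blast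
    ultimately show ?thesis using * by (blast intro: fwd.intros)
  qed
next
  case (fwd_parR Y0 \<theta> Y' X)
  from fwd_parR.prems(1) show ?case
  proof (rule fwd_to_ParE)
    fix Z \<phi> assume *: "\<theta>2 = push L \<phi>" "Y = Par Z Y'" "Z \<midarrow>\<phi>\<rightarrow> X" "lkey \<phi> \<notin> keys Y'"
    then have "lkey \<phi> \<notin> keys Y0" "lkey \<theta> \<notin> keys Z"
      using fwd_keys fwd_parR.hyps by blast+
    then show ?thesis using * fwd_parR.hyps by (blast intro: fwd.intros)
  next
    fix Z \<phi> assume *: "\<theta>2 = push R \<phi>" "Y = Par X Z" "Z \<midarrow>\<phi>\<rightarrow> Y'" "lkey \<phi> \<notin> keys X"
    then have "\<not> \<theta> \<lessdot> \<phi>" using fwd_parR.prems(2) by (auto intro: dep_push)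
    with fwd_parR.IH * obtain X2 where "X2 \<midarrow>\<phi>\<rightarrow> Y0" "X2 \<midarrow>\<theta>\<rightarrow> Z" by blast
    then show ?thesis using * fwd_parR.hyps by (blast intro: fwd.intros)
  next
    fix Z v \<alpha> k Z' w
    assume *: "\<theta>2 = Syn [] v \<alpha> w k" "Y = Par Z Z'"
      "Z \<midarrow>Act v \<alpha> k\<rightarrow> X" "Z' \<midarrow>Act w (bar \<alpha>) k\<rightarrow> Y'" "\<alpha> \<noteq> Tau"
    then have "\<not> \<theta> \<lessdot> Act w (bar \<alpha>) k" using fwd_parR.prems(2) by (auto intro: push_R_Act_dep)
    with fwd_parR.IH * obtain X2 where "X2 \<midarrow>Act w (bar \<alpha>) k\<rightarrow> Y0" "X2 \<midarrow>\<theta>\<rightarrow> Z'" by blast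
    moreover have "lkey \<theta> \<notin> keys Z" using fwd_keys * fwd_parR.hyps by blast
    ultimately show ?thesis using * by (blast intro: fwd.intros)
  qed
next
  case (fwd_syn X v \<alpha> k X' Y0 w Y')
  from fwd_syn.prems(1) show ?case
  proof (rule fwd_to_ParE)
    fix Z \<phi> assume *: "\<theta>2 = push L \<phi>" "Y = Par Z Y'" "Z \<midarrow>\<phi>\<rightarrow> X'" "lkey \<phi> \<notin> keys Y'"
    then have "\<not> Act v \<alpha> k \<lessdot> \<phi>" using fwd_syn.prems(2) by (auto intro: push_L_Act_dep)
    with fwd_syn.IH(1) * obtain X2 where "X2 \<midarrow>\<phi>\<rightarrow> X" "X2 \<midarrow>Act v \<alpha> k\<rightarrow> Z" by blast
    moreover have "lkey \<phi> \<notin> keys Y0" using fwd_keys * fwd_syn.hyps by blast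
    ultimately show ?thesis using * fwd_syn.hyps by (blast intro: fwd.intros)
  next
    fix Z \<phi> assume *: "\<theta>2 = push R \<phi>" "Y = Par X' Z" "Z \<midarrow>\<phi>\<rightarrow> Y'" "lkey \<phi> \<notin> keys X'"
    then have "\<not> Act w (bar \<alpha>) k \<lessdot> \<phi>" using fwd_syn.prems(2) by (auto intro: push_R_Act_dep)
    with fwd_syn.IH(2) * obtain X2 where "X2 \<midarrow>\<phi>\<rightarrow> Y0" "X2 \<midarrow>Act w (bar \<alpha>) k\<rightarrow> Z" by blast
    moreover have "lkey \<phi> \<notin> keys X" using fwd_keys * fwd_syn.hyps by blast
    ultimately show ?thesis using * fwd_syn.hyps by (blast intro: fwd.intros)
  next
    fix Z v' \<alpha>' k' Z' w'
    assume *: "\<theta>2 = Syn [] v' \<alpha>' w' k'" "Y = Par Z Z'"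
      "Z \<midarrow>Act v' \<alpha>' k'\<rightarrow> X'" "Z' \<midarrow>Act w' (bar \<alpha>') k'\<rightarrow> Y'" "\<alpha>' \<noteq> Tau"
    \<comment> \<open>A dependency in one component would already relate the two synchronisations,
      so both components are independent and their origins pair up as
      \<open>Par X2 Y2\<close>.\<close>
    then have "\<not> Act v \<alpha> k \<lessdot> Act v' \<alpha>' k'" "\<not> Act w (bar \<alpha>) k \<lessdot> Act w' (bar \<alpha>') k'"
      using fwd_syn.prems(2) by (auto intro: Syn_dep_SynI)
    with fwd_syn.IH * obtain X2 Y2
      where "X2 \<midarrow>Act v' \<alpha>' k'\<rightarrow> X" "X2 \<midarrow>Act v \<alpha> k\<rightarrow> Z"
        and "Y2 \<midarrow>Act w' (bar \<alpha>') k'\<rightarrow> Y0" "Y2 \<midarrow>Act w (bar \<alpha>) k\<rightarrow> Z'"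
      by blast
    then show ?thesis using * fwd_syn.hyps by (blast intro: fwd.intros)
  qed
next
  case (fwd_sumL X \<theta> X' Y0)
  from fwd_sumL.prems(1) show ?case
    \<comment> \<open>Transitions in opposite summands are impossible: \<open>Y0\<close> would be
      both standard and a target.\<close>
    by (rule fwd_to_ChoiceE) (use fwd_sumL fwd_not_std in \<open>blast intro: fwd.intros\<close>)+
next
  case (fwd_sumR Y0 \<theta> Y' X)
  from fwd_sumR.prems(1) show ?case
    by (rule fwd_to_ChoiceE) (use fwd_sumR fwd_not_std in \<open>blast intro: fwd.intros\<close>)+
qed

lemma trace_snoc: "trace X T Y \<Longrightarrow> Y \<midarrow>\<theta>\<Rrightarrow> Z \<Longrightarrow> trace X (T @ [\<theta>]) Z"
  by (induction rule: trace.induct) (auto intro: trace.intros)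

lemma reachable_step: "reachable X \<Longrightarrow> X \<midarrow>\<theta>\<Rrightarrow> Y \<Longrightarrow> reachable Y"
  unfolding reachable_def by (blast intro: trace_snoc)

theorem theorem2:
  fixes X X1 Y :: "('n, 'k) proc" and \<theta>1 \<theta>2 :: "('n, 'k) elabel"
  assumes "reachable X" and "reachable X1" and "reachable Y"
    and "X \<midarrow>\<theta>1\<rightarrow> X1" and "X1 \<midarrow>\<theta>2\<leadsto> Y"
    and "concurrent_in [\<theta>1, \<theta>2] 0 1"
  shows "\<exists>X2. reachable X2 \<and> X \<midarrow>\<theta>2\<leadsto> X2 \<and> X2 \<midarrow>\<theta>1\<rightarrow> Y"
proof -
  have "\<not> \<theta>1 \<lessdot> \<theta>2"
    using assms(6) by (simp add: concurrent_in_def dep_in_def)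
  then obtain X2 where "X \<midarrow>\<theta>2\<leadsto> X2" "X2 \<midarrow>\<theta>1\<rightarrow> Y"
    using fwd_common_origin assms(4,5) unfolding bwd_iff_fwd by blast
  then show ?thesis
    \<comment> \<open>Traces may contain backward steps, so undoing \<open>\<theta>2\<close> from
      \<open>X\<close> stays within the reachable processes.\<close>
    using assms(1) reachable_step unfolding step_def by blast
qed

end
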